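(* Let $J=(q_i)_{i\ge1}$ be a sequence of non-negative integers with $\gcd(q_i,q_j)=1$ for all $i\neq j$, and let $I=(a_j)_{j\ge1}$ be a sequence with every $a_j\in J$ and each $q_i$ appearing infinitely many times in $I$. Let $\mathfrak{n}(I)=\prod_{j\ge1}a_j$ and let $\mathfrak{m}$ be an infinite generalized integer coprime with $\mathfrak{n}(I)$. Then there exists a simple Riesz group of rank one $(G,G^+)$, isomorphic as an abelian group to $\mathbb{Z}_{\mathfrak{n}(I)\cdot\mathfrak{m}}$, which contains a sequence $(D_i)_{i\ge1}$ of unbounded countably generated intervals, descending in the algebraic ordering of the monoid of countably generated intervals (for each $i$ there is a countably generated interval $Y_i$ with $D_{i+1}+Y_i=D_i$), such that $\left(\prod_{j=1}^i q_j\right)D_i=G^+$ for all $i$ and $tD_i\neq G^+$ for every positive integer $t\le q_i-1$.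
   Context: Partially ordered abelian group $(G,G^+)$; simple: $G\neq0$ and every nonzero $u\in G^+$ is an order-unit (for all $x$ there is $n$ with $-nu\le x\le nu$). Riesz group: $x\le y_1+y_2$ in $G^+$ implies $x=x_1+x_2$, $x_j\in G^+$, $x_j\le y_j$. Rank one: isomorphic to a nonzero subgroup of $\mathbb{Q}$. Generalized integers: maps from primes to $\{0,1,\dots,\infty\}$; $\prod_j a_j$ has at a prime $\ell$ the sum of the exponents of $\ell$ in the $a_j$; infinite means not (never $\infty$ and nonzero at finitely many primes); coprime means at each prime one exponent is $0$; products add exponents. $\mathbb{Z}_{\mathfrak{n}}=\{a/b\in\mathbb{Q}: b\mid\mathfrak{n}\}$. An interval in $G^+$ is a nonempty, upward directed, order-hereditary subset of $G^+$; countably generated if it has a countable cofinal subset; $X+Y=\{z\in G^+: z\le x+y,\ x\in X,\ y\in Y\}$, $tX$ the $t$-fold sum. An interval $D$ is unbounded if for an order-unit $u$ and every state $s$ on $(G,u)$ (homomorphism $s\colon G\to\mathbb{R}$, $s(G^+)\subseteq\mathbb{R}^+$, $s(u)=1$) one has $\sup_{x\in D}s(x)=\infty$.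
   Formalization: The q_i are taken to be positive integers rather than non-negative ones: if some q_i were 0, the exponents of primes in 0, and so the generalized integer n(I), would be undefined, and a 0-fold sum of intervals could not equal G^+. *)

theory Defs
  imports "HOL-Computational_Algebra.Primes" "HOL-Library.Extended_Nat" "HOL-Library.Countable_Set"
begin

definition le_P :: "rat set \<Rightarrow> rat \<Rightarrow> rat \<Rightarrow> bool" where
  "le_P P x y \<longleftrightarrow> y - x \<in> P"

definition pogroup :: "rat set \<Rightarrow> rat set \<Rightarrow> bool" where
  "pogroup G P \<longleftrightarrow> 0 \<in> G \<and> (\<forall>x\<in>G. \<forall>y\<in>G. x + y \<in> G) \<and> (\<forall>x\<in>G. - x \<in> G) \<and>
     P \<subseteq> G \<and> 0 \<in> P \<and> (\<forall>x\<in>P. \<forall>y\<in>P. x + y \<in> P) \<and> (\<forall>x\<in>P. - x \<in> P \<longrightarrow> x = 0)"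

definition order_unit :: "rat set \<Rightarrow> rat set \<Rightarrow> rat \<Rightarrow> bool" where
  "order_unit G P u \<longleftrightarrow> u \<in> P \<and>
     (\<forall>x\<in>G. \<exists>n::nat. le_P P (- (of_nat n * u)) x \<and> le_P P x (of_nat n * u))"

definition simple_pog :: "rat set \<Rightarrow> rat set \<Rightarrow> bool" where
  "simple_pog G P \<longleftrightarrow> pogroup G P \<and> G \<noteq> {0} \<and> (\<forall>u\<in>P. u \<noteq> 0 \<longrightarrow> order_unit G P u)"

definition riesz_group :: "rat set \<Rightarrow> rat set \<Rightarrow> bool" where
  "riesz_group G P \<longleftrightarrow> pogroup G P \<and>
     (\<forall>x y1 y2. x \<in> P \<and> y1 \<in> P \<and> y2 \<in> P \<and> le_P P x (y1 + y2) \<longrightarrow>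
        (\<exists>x1\<in>P. \<exists>x2\<in>P. x = x1 + x2 \<and> le_P P x1 y1 \<and> le_P P x2 y2))"

definition rank_one :: "rat set \<Rightarrow> bool" where
  "rank_one G \<longleftrightarrow> (\<exists>f :: rat \<Rightarrow> rat. inj_on f G \<and> (\<forall>x\<in>G. \<forall>y\<in>G. f (x + y) = f x + f y)
      \<and> f ` G \<noteq> {0})"

definition interval :: "rat set \<Rightarrow> rat set \<Rightarrow> bool" where
  "interval P D \<longleftrightarrow> D \<noteq> {} \<and> D \<subseteq> P \<and>
     (\<forall>x\<in>D. \<forall>y\<in>D. \<exists>z\<in>D. le_P P x z \<and> le_P P y z) \<and>
     (\<forall>x\<in>D. \<forall>y\<in>P. le_P P y x \<longrightarrow> y \<in> D)"

definition cg_interval :: "rat set \<Rightarrow> rat set \<Rightarrow> bool" where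
  "cg_interval P D \<longleftrightarrow> interval P D \<and>
     (\<exists>C. countable C \<and> C \<subseteq> D \<and> (\<forall>x\<in>D. \<exists>c\<in>C. le_P P x c))"

definition iplus :: "rat set \<Rightarrow> rat set \<Rightarrow> rat set \<Rightarrow> rat set" where
  "iplus P X Y = {z \<in> P. \<exists>x\<in>X. \<exists>y\<in>Y. le_P P z (x + y)}"

primrec imult :: "rat set \<Rightarrow> nat \<Rightarrow> rat set \<Rightarrow> rat set" where
  "imult P 0 X = {0}"
| "imult P (Suc n) X = iplus P X (imult P n X)"

definition state :: "rat set \<Rightarrow> rat set \<Rightarrow> rat \<Rightarrow> (rat \<Rightarrow> real) \<Rightarrow> bool" where
  "state G P u s \<longleftrightarrow> (\<forall>x\<in>G. \<forall>y\<in>G. s (x + y) = s x + s y) \<and> (\<forall>x\<in>P. s x \<ge> 0) \<and> s u = 1"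

definition unbounded_interval :: "rat set \<Rightarrow> rat set \<Rightarrow> rat set \<Rightarrow> bool" where
  "unbounded_interval G P D \<longleftrightarrow> (\<exists>u. order_unit G P u \<and>
     (\<forall>s. state G P u s \<longrightarrow> (\<forall>M::real. \<exists>x\<in>D. s x > M)))"

text \<open>A generalized integer is a map from primes to exponents in {0,1,...,\<infinity>};
  only its values at primes matter.\<close>
type_synonym genint = "nat \<Rightarrow> enat"

definition gi_mult :: "genint \<Rightarrow> genint \<Rightarrow> genint" where
  "gi_mult m n = (\<lambda>p. m p + n p)"

definition gi_prod :: "(nat \<Rightarrow> nat) \<Rightarrow> genint" where
  "gi_prod a = (\<lambda>p. SUP k. enat (\<Sum>j\<in>{1..k}. multiplicity p (a j)))"

definition gi_infinite :: "genint \<Rightarrow> bool" where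
  "gi_infinite m \<longleftrightarrow> \<not> ((\<forall>p. prime p \<longrightarrow> m p \<noteq> \<infinity>) \<and> finite {p. prime p \<and> m p \<noteq> 0})"

definition gi_coprime :: "genint \<Rightarrow> genint \<Rightarrow> bool" where
  "gi_coprime m n \<longleftrightarrow> (\<forall>p. prime p \<longrightarrow> m p = 0 \<or> n p = 0)"

definition gi_dvd :: "nat \<Rightarrow> genint \<Rightarrow> bool" where
  "gi_dvd b n \<longleftrightarrow> b > 0 \<and> (\<forall>p. prime p \<longrightarrow> enat (multiplicity p b) \<le> n p)"

definition Zgi :: "genint \<Rightarrow> rat set" where
  "Zgi n = {x. \<exists>(a::int) (b::nat). gi_dvd b n \<and> x = of_int a / of_nat b}"

end

theory Submission
  imports Defs "HOL-Number_Theory.Cong"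
begin

text \<open>The cone is the union of a tower of cones \<open>P\<^sub>n\<close> in the cyclic groups \<open>(1/N\<^sub>n)\<int>\<close>, each
  containing all sufficiently large elements of its group and each restricting to its predecessor.
  Two moves alternate. To refine \<open>x \<le> y\<^sub>1 + y\<^sub>2\<close>, one adjoins the entries of a refinement matrix,
  all of them congruent to \<open>\<plusminus>a\<close> modulo the old group for some \<open>a\<close> of huge order; by the size of
  that order no new element of the old group becomes positive. To build the intervals, one adjoins
  a root \<open>W\<^sub>n/M\<close> of a large \<open>W\<^sub>n\<close> of the old cone, where \<open>Q\<^sub>n = q\<^sub>1 \<cdots> q\<^sub>n\<close> divides \<open>M\<close>. The interval
  \<open>D\<^sub>i\<close> is generated by the partial sums of the \<open>W\<^sub>j/Q\<^sub>i\<close> with \<open>j \<ge> i\<close>: its \<open>Q\<^sub>i\<close>-fold sum absorbs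
  everything, while for \<open>t < Q\<^sub>i\<close> the multiples \<open>t W\<^sub>j/Q\<^sub>i\<close> cannot help an element of the old group
  to become positive.\<close>

section \<open>Numerical cones in cyclic groups\<close>

definition frac_grp :: "nat \<Rightarrow> rat set" where
  "frac_grp N = {x. of_nat N * x \<in> \<int>}"

text \<open>Multiplied by \<open>N\<close>, these are the numerical semigroups: submonoids of the
  natural numbers with finite complement. The number \<open>R\<close> bounds the conductor.\<close>

definition good_cone :: "nat \<Rightarrow> rat set \<Rightarrow> bool" where
  "good_cone N P \<longleftrightarrow> 0 < N \<and> P \<subseteq> frac_grp N \<and> 0 \<in> P \<and> (\<forall>x\<in>P. \<forall>y\<in>P. x + y \<in> P) \<and>
     (\<forall>x\<in>P. 0 \<le> x) \<and> (\<exists>R. \<forall>x\<in>frac_grp N. R \<le> x \<longrightarrow> x \<in> P)"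

lemma frac_grp_add: "x \<in> frac_grp N \<Longrightarrow> y \<in> frac_grp N \<Longrightarrow> x + y \<in> frac_grp N"
  by (simp add: frac_grp_def distrib_left)

lemma frac_grp_diff: "x \<in> frac_grp N \<Longrightarrow> y \<in> frac_grp N \<Longrightarrow> x - y \<in> frac_grp N"
  by (simp add: frac_grp_def right_diff_distrib)

lemma frac_grp_minus: "x \<in> frac_grp N \<Longrightarrow> - x \<in> frac_grp N"
  by (simp add: frac_grp_def)

lemma frac_grp_mult_Ints: "x \<in> frac_grp N \<Longrightarrow> k \<in> \<int> \<Longrightarrow> k * x \<in> frac_grp N"
  by (simp add: frac_grp_def mult.left_commute)

lemma frac_grp_mono:
  assumes "N dvd N'"
  shows "frac_grp N \<subseteq> frac_grp N'"
proof
  fix x assume x: "x \<in> frac_grp N"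
  obtain k where "N' = k * N" using assms by (metis dvdE mult.commute)
  hence "of_nat N' * x = of_nat k * (of_nat N * x)" by simp
  also have "\<dots> \<in> \<int>"
    using x unfolding frac_grp_def mem_Collect_eq by (rule Ints_mult[OF Ints_of_nat])
  finally show "x \<in> frac_grp N'" unfolding frac_grp_def by simp
qed

lemma frac_grp_fraction: "N > 0 \<Longrightarrow> of_int i / of_nat N \<in> frac_grp N"
  by (simp add: frac_grp_def)

lemma frac_grpE:
  assumes "x \<in> frac_grp N" "N > 0"
  obtains i where "x = of_int i / of_nat N"
  using assms by (auto simp: frac_grp_def field_simps elim!: Ints_cases)

lemma good_coneD:
  assumes "good_cone N P"
  shows "0 < N" "P \<subseteq> frac_grp N" "0 \<in> P"
    "x \<in> P \<Longrightarrow> y \<in> P \<Longrightarrow> x + y \<in> P" "x \<in> P \<Longrightarrow> 0 \<le> x"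
  using assms by (auto simp: good_cone_def)

lemma good_cone_conductor:
  assumes "good_cone N P"
  obtains R where "\<And>x. x \<in> frac_grp N \<Longrightarrow> R \<le> x \<Longrightarrow> x \<in> P"
  using assms unfolding good_cone_def by blast

lemma closed_of_nat_mult:
  assumes "0 \<in> P" "\<And>x y. x \<in> P \<Longrightarrow> y \<in> P \<Longrightarrow> x + y \<in> (P :: rat set)" "x \<in> P"
  shows "of_nat n * x \<in> P"
  by (induction n) (auto simp: distrib_right assms)

section \<open>Cyclic quotients of fraction groups and extensions of cones\<close>

lemma fraction_order:
  assumes "N > 0" "M > 0" "coprime i (int M)" "of_int k * (of_int i / of_nat (N * M)) \<in> frac_grp N"
  shows "int M dvd k"
proof -
  have "(of_nat N :: rat) * (of_int k * (of_int i / of_nat (N * M))) = of_int (k * i) / of_nat M"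
    using assms by simp
  then obtain j where "of_int (k * i) / of_nat M = (of_int j :: rat)"
    using assms(4) unfolding frac_grp_def by (metis (lifting) Ints_cases mem_Collect_eq)
  hence "(of_int (k * i) :: rat) = of_int (j * int M)"
    using assms by (simp add: field_simps)
  hence "k * i = j * int M" by (simp only: of_int_eq_iff)
  hence "int M dvd k * i" by simp
  thus ?thesis using assms(3) by (simp add: coprime_commute coprime_dvd_mult_left_iff)
qed

text \<open>The quotient of \<open>frac_grp (N * M)\<close> by \<open>frac_grp N\<close> is cyclic
  of order \<open>M\<close>, and a numerator prime to \<open>M\<close> represents a generator.
  Inverting that numerator modulo \<open>M\<close> produces the residue \<open>t\<close>.\<close>

lemma fraction_class:
  assumes "N > 0" "M > 0" "coprime i (int M)" "x \<in> frac_grp (N * M)"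
  shows "\<exists>t<M. x - of_nat t * (of_int i / of_nat (N * M)) \<in> frac_grp N"
proof -
  obtain k where k: "x = of_int k / of_nat (N * M)"
    using assms frac_grpE by (metis mult_pos_pos)
  obtain i' where i': "[i * i' = 1] (mod int M)"
    using cong_solve_coprime_int[OF assms(3)] by blast
  define t where "t = nat ((i' * k) mod int M)"
  have t: "int t = (i' * k) mod int M" "t < M"
    using assms(2) by (auto simp: t_def nat_less_iff)
  have "[int t * i = i' * k * i] (mod int M)"
    by (simp add: t cong_def mod_mult_left_eq)
  also have "[i' * k * i = k * (i * i')] (mod int M)" by (simp add: mult_ac)
  also have "[k * (i * i') = k * 1] (mod int M)" by (intro cong_mult i') auto
  finally have "int M dvd k - int t * i"
    by (simp add: cong_iff_dvd_diff dvd_diff_commute)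
  then obtain j where j: "k - int t * i = int M * j" by blast
  have "of_nat N * (x - of_nat t * (of_int i / of_nat (N * M)))
      = (of_int (k - int t * i) / of_nat M :: rat)"
    using assms(1,2) by (simp add: k field_simps)
  also have "\<dots> = of_int j" using assms(2) by (simp add: j)
  finally show ?thesis using t(2) unfolding frac_grp_def by auto
qed

text \<open>The point is the conductor. Subtracting fewer than \<open>M\<close> copies of the new
  fraction \<open>f\<close> moves any element into \<open>frac_grp N\<close>, so
  \<open>R + M * f\<close> is a bound for the new cone when \<open>R\<close> is one for the
  old.\<close>

lemma good_cone_extend:
  assumes P: "good_cone N P" and M: "M > 0" "coprime i (int M)"
    and sub: "P \<subseteq> P'" "P' \<subseteq> frac_grp (N * M)"
    and add: "\<And>x y. x \<in> P' \<Longrightarrow> y \<in> P' \<Longrightarrow> x + y \<in> P'"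
    and nonneg: "\<And>x. x \<in> P' \<Longrightarrow> 0 \<le> x"
    and f: "of_int i / of_nat (N * M) \<in> P'"
  shows "good_cone (N * M) P'"
proof -
  define f where "f = (of_int i / of_nat (N * M) :: rat)"
  have N: "N > 0" and zero: "0 \<in> P'" using good_coneD[OF P] sub by auto
  obtain R where R: "\<And>x. x \<in> frac_grp N \<Longrightarrow> R \<le> x \<Longrightarrow> x \<in> P"
    using good_cone_conductor[OF P] by blast
  have "x \<in> P'" if x: "x \<in> frac_grp (N * M)" "R + of_nat M * f \<le> x" for x
  proof -
    obtain t where t: "t < M" "x - of_nat t * f \<in> frac_grp N"
      using fraction_class[OF N M x(1)] unfolding f_def by blast
    have "of_nat t * f \<le> of_nat M * f"
      using t(1) nonneg[OF f] unfolding f_def by (intro mult_right_mono) auto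
    hence "x - of_nat t * f \<in> P'" using R t(2) x(2) sub(1) by force
    moreover have "of_nat t * f \<in> P'"
      using closed_of_nat_mult[of P'] zero add f unfolding f_def by blast
    ultimately show ?thesis using add by fastforce
  qed
  hence "\<exists>R. \<forall>x\<in>frac_grp (N * M). R \<le> x \<longrightarrow> x \<in> P'" by blast
  thus ?thesis using N M(1) sub add nonneg zero by (simp add: good_cone_def)
qed

text \<open>The element adjoined here has order \<open>M\<close> over \<open>frac_grp N\<close> and its multiple \<open>W\<close> already
  lies in the cone, so a representation in the new cone is determined modulo \<open>W\<close>.\<close>

lemma good_cone_adjoin_root:
  assumes P: "good_cone N P" and M: "M > 0"
  shows "\<exists>W P'. good_cone (N * M) P' \<and> P \<subseteq> P' \<and> B \<le> W \<and>
    (\<forall>z\<in>frac_grp N. z \<le> B \<longrightarrow> W - z \<in> P) \<and>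
    (\<forall>Q. Q dvd M \<longrightarrow> W / of_nat Q \<in> P' \<and>
      (\<forall>t<Q. \<forall>g\<in>frac_grp N. of_nat t * (W / of_nat Q) + g \<in> P' \<longrightarrow> g \<in> P))"
proof -
  have N: "N > 0" using good_coneD[OF P] by auto
  obtain R where R: "\<And>x. x \<in> frac_grp N \<Longrightarrow> R \<le> x \<Longrightarrow> x \<in> P"
    using good_cone_conductor[OF P] by blast
  \<comment> \<open>The size of \<open>s\<close> makes \<open>W = i / N\<close> at least
    \<open>max B 0 + max R 0\<close>, so that \<open>W - z\<close> passes the conductor whenever
    \<open>z \<le> B\<close>. The numerator \<open>i\<close> is 1 modulo \<open>M\<close>, hence
    prime to \<open>M\<close>.\<close>
  obtain s :: nat where s: "of_nat s \<ge> of_nat N * (max B 0 + max R 0)"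
    using real_arch_simple by blast
  define i where "i = 1 + int M * int s"
  define f where "f = (of_int i / of_nat (N * M) :: rat)"
  define W where "W = of_nat M * f"
  define P' where "P' = {p + of_nat n * f | p n. p \<in> P}"
  have i: "coprime i (int M)"
  proof (rule coprimeI)
    fix c assume "c dvd i" "c dvd int M"
    thus "is_unit c" unfolding i_def by (metis dvd_add_left_iff dvd_mult2)
  qed
  have f0: "0 \<le> f" unfolding f_def i_def by (auto intro!: divide_nonneg_nonneg)
  have Weq: "W = of_int i / of_nat N" using M N by (simp add: W_def f_def)
  have WG: "W \<in> frac_grp N" using N by (simp add: Weq frac_grp_fraction)
  have "of_nat N * (max B 0 + max R 0) \<le> (of_int i :: rat)"
  proof -
    have "s \<le> M * s" using M by simp
    hence "(of_nat s :: rat) \<le> of_nat (M * s)" by (simp only: of_nat_le_iff)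
    thus ?thesis using s unfolding i_def by simp
  qed
  hence Wbig: "max B 0 + max R 0 \<le> W"
    using N by (simp add: Weq field_simps)
  have WP: "W \<in> P" using R WG Wbig by auto
  have Pmult: "of_nat n * x \<in> P" if "x \<in> P" for n x
    using closed_of_nat_mult[of P] good_coneD[OF P] that by blast
  have fP': "of_nat n * f \<in> P'" for n
    unfolding P'_def using good_coneD(3)[OF P] by force
  have sub: "P \<subseteq> P'" unfolding P'_def by force
  have good: "good_cone (N * M) P'"
  proof (rule good_cone_extend[OF P M i sub])
    show "P' \<subseteq> frac_grp (N * M)"
    proof
      fix x assume "x \<in> P'"
      then obtain p n where x: "x = p + of_nat n * f" "p \<in> P" unfolding P'_def by blast
      have "p \<in> frac_grp (N * M)"
        using x(2) good_coneD(2)[OF P] frac_grp_mono[of N "N * M"] by auto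
      moreover have "f \<in> frac_grp (N * M)" 
        unfolding f_def by (rule frac_grp_fraction) (use M N in auto)
      ultimately show "x \<in> frac_grp (N * M)"
        unfolding x by (intro frac_grp_add frac_grp_mult_Ints) auto
    qed
    show "x + y \<in> P'" if xy: "x \<in> P'" "y \<in> P'" for x y
    proof -
      obtain p n p' n' where "x = p + of_nat n * f" "p \<in> P" "y = p' + of_nat n' * f" "p' \<in> P"
        using xy unfolding P'_def by blast
      hence "x + y = (p + p') + of_nat (n + n') * f \<and> p + p' \<in> P"
        using good_coneD(4)[OF P] by (simp add: algebra_simps)
      thus ?thesis unfolding P'_def by blast
    qed
    show "0 \<le> x" if "x \<in> P'" for x
      using that f0 good_coneD(5)[OF P] unfolding P'_def by (auto intro!: add_nonneg_nonneg)
    show "of_int i / of_nat (N * M) \<in> P'" using fP'[of 1] unfolding f_def by simp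
  qed
  moreover have "W - z \<in> P" if "z \<in> frac_grp N" "z \<le> B" for z
    using R[of "W - z"] frac_grp_diff[OF WG that(1)] that(2) Wbig by auto
  moreover have "W / of_nat Q \<in> P' \<and>
      (\<forall>t<Q. \<forall>g\<in>frac_grp N. of_nat t * (W / of_nat Q) + g \<in> P' \<longrightarrow> g \<in> P)" if QM: "Q dvd M" for Q
  proof -
    obtain k where k: "M = Q * k" using QM by (elim dvdE)
    have Q: "Q > 0" using k M by (cases Q) auto
    have WQ: "W / of_nat Q = of_nat k * f" using Q by (simp add: W_def k)
    have "g \<in> P" if tg: "t < Q" "g \<in> frac_grp N" "of_nat t * (W / of_nat Q) + g \<in> P'" for t g
    proof -
      obtain p n where p: "of_nat t * (of_nat k * f) + g = p + of_nat n * f" "p \<in> P"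
        using tg(3) unfolding P'_def WQ by blast
      have eq: "of_int (int n - int (t * k)) * f = g - p" using p(1) by (simp add: algebra_simps)
      have "g - p \<in> frac_grp N" using tg(2) p(2) good_coneD(2)[OF P] frac_grp_diff by blast
      hence "int M dvd int n - int (t * k)"
        using fraction_order[OF N M i] eq unfolding f_def by metis
      then obtain j where j: "int n - int (t * k) = int M * j" by blast
      \<comment> \<open>Here \<open>t * (W / Q)\<close> consists of \<open>t * k\<close> copies of
        \<open>f\<close>, fewer than \<open>M\<close>. The surplus \<open>n - t * k\<close> is a
        multiple of \<open>M\<close> above \<open>-M\<close>, hence nonnegative, and so amounts to
        copies of \<open>W\<close>, which lie in \<open>P\<close>.\<close>
      have "t * k < M" using tg(1) k M by simp
      hence "0 \<le> j"
      proof -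
        have "int (t * k) < int M" using \<open>t * k < M\<close> by (simp only: of_nat_less_iff)
        hence "int M * (-1) < int M * j" using j by linarith
        hence "-1 < j" using M by (subst (asm) mult_less_cancel_left_pos) auto
        thus ?thesis by simp
      qed
      then obtain l where "j = int l" using nonneg_int_cases by blast
      hence "g = p + of_nat l * W" using eq unfolding j by (simp add: W_def algebra_simps)
      thus ?thesis using p(2) Pmult[OF WP] good_coneD(4)[OF P] by blast
    qed
    moreover have "W / of_nat Q \<in> P'" using fP' WQ by simp
    ultimately show ?thesis by blast
  qed
  ultimately show ?thesis using sub Wbig by (intro exI[of _ W] exI[of _ P']) auto
qed

section \<open>Adjoining a refinement matrix\<close>

text \<open>For a prime power only multiples of one prime fail to be coprime to it, and that prime
  cannot divide two consecutive integers. This is why the refinement step works with prime powers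
  \<open>M\<close>.\<close>

lemma coprime_prime_power_near:
  fixes M p :: nat
  assumes "prime p" "M = p ^ e"
  shows "\<exists>i\<in>{j, j + 1}. coprime i (int M)"
proof -
  have "\<not> (int p dvd j \<and> int p dvd j + 1)"
    using assms(1) by (metis dvd_add_right_iff int_dvd_int_iff nat_dvd_1_iff_1 not_prime_1 of_nat_1)
  moreover have "coprime i (int M)" if "\<not> int p dvd i" for i
    using that assms prime_imp_coprime[of "int p" i]
    by (auto simp: coprime_commute)
  ultimately show ?thesis by blast
qed

text \<open>The class of \<open>a\<close> modulo \<open>frac_grp N\<close> has order \<open>M\<close>; an element of \<open>frac_grp N\<close> written with
  the four new generators either pairs them up into elements of \<open>P\<close>, or uses at least \<open>M\<close> of them
  and is then so large that it is in \<open>P\<close> anyway.\<close>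

lemma good_cone_adjoin_refinement:
  assumes P: "good_cone N P"
    and mem: "x \<in> P" "y1 \<in> P" "y2 \<in> P" "y1 + y2 - x \<in> P"
    and pos: "0 < x" "0 < y1" "0 < y2" "x < y1 + y2"
  shows "\<exists>B. \<forall>M p e. prime p \<longrightarrow> M = p ^ e \<longrightarrow> B \<le> M \<longrightarrow>
    (\<exists>P'. good_cone (N * M) P' \<and> P \<subseteq> P' \<and> P' \<inter> frac_grp N \<subseteq> P \<and>
      (\<exists>x1\<in>P'. \<exists>x2\<in>P'. x = x1 + x2 \<and> y1 - x1 \<in> P' \<and> y2 - x2 \<in> P'))"
proof -
  have N: "N > 0" using good_coneD[OF P] by auto
  obtain R where R: "\<And>x. x \<in> frac_grp N \<Longrightarrow> R \<le> x \<Longrightarrow> x \<in> P"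
    using good_cone_conductor[OF P] by blast
  \<comment> \<open>The entries \<open>a\<close>, \<open>x - a\<close>, \<open>y1 - a\<close>,
    \<open>y2 - (x - a)\<close> are all positive exactly when \<open>lo < a < hi\<close>. In the
    middle half of this range all four are at least \<open>\<mu>\<close>.\<close>
  define lo where "lo = max 0 (x - y2)"
  define hi where "hi = min x y1"
  define \<mu> where "\<mu> = (hi - lo) / 4"
  have \<mu>: "\<mu> > 0" using pos by (auto simp: \<mu>_def hi_def lo_def)
  \<comment> \<open>\<open>B1\<close> ensures that any \<open>M\<close> of the new generators sum to
    at least \<open>R\<close>; \<open>B2\<close> ensures that the grid of mesh
    \<open>1 / (N * M)\<close> is no coarser than \<open>\<mu>\<close>.\<close>
  obtain B1 :: nat where B1: "of_nat B1 \<ge> max 0 R / \<mu>" using real_arch_simple by blast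
  obtain B2 :: nat where B2: "of_nat B2 \<ge> 1 / \<mu>" using real_arch_simple by blast
  have main: "\<exists>P'. good_cone (N * M) P' \<and> P \<subseteq> P' \<and> P' \<inter> frac_grp N \<subseteq> P \<and>
      (\<exists>x1\<in>P'. \<exists>x2\<in>P'. x = x1 + x2 \<and> y1 - x1 \<in> P' \<and> y2 - x2 \<in> P')"
    if pr: "prime (p::nat)" and Mpe: "M = p ^ e" and MB: "B1 + B2 \<le> M" for M p e
  proof -
    have M: "M > 0" using pr Mpe by (simp add: prime_gt_0_nat)
    have "(of_nat (B1 + B2) :: rat) \<le> of_nat M" using MB by (simp only: of_nat_le_iff)
    hence "max 0 R / \<mu> \<le> of_nat M" "1 / \<mu> \<le> of_nat M" using B1 B2 by auto
    hence M1: "R \<le> of_nat M * \<mu>" and M2: "1 \<le> of_nat M * \<mu>"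
      using \<mu> by (auto simp: divide_le_eq)
    have "of_nat M * \<mu> \<le> of_nat (N * M) * \<mu>"
      using N \<mu> by (intro mult_right_mono of_nat_mono) auto
    hence NM: "1 \<le> of_nat (N * M) * \<mu>" using M2 by linarith
    have NM0: "of_nat (N * M) > (0::rat)" using N M by simp
    \<comment> \<open>The middle half has length \<open>2 * \<mu>\<close>, at least two grid steps,
      so both candidate numerators \<open>j\<close> and \<open>j + 1\<close> keep \<open>a\<close>
      inside it.\<close>
    define j where "j = \<lceil>of_nat (N * M) * (lo + \<mu>)\<rceil>"
    obtain i where i: "i = j \<or> i = j + 1" "coprime i (int M)"
      using coprime_prime_power_near[OF pr Mpe, of j] by blast
    define a where "a = (of_int i / of_nat (N * M) :: rat)"
    have ij: "of_int j \<le> (of_int i :: rat)" "(of_int i :: rat) \<le> of_int j + 1" using i(1) by auto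
    have "of_nat (N * M) * (lo + \<mu>) \<le> of_int i" using ij(1) unfolding j_def by linarith
    hence a_lo: "lo + \<mu> \<le> a" using NM0 unfolding a_def by (simp add: pos_le_divide_eq mult.commute)
    have "of_int i \<le> of_nat (N * M) * (lo + \<mu>) + 2" using ij(2) unfolding j_def by linarith
    also have "\<dots> \<le> of_nat (N * M) * (lo + \<mu>) + 2 * (of_nat (N * M) * \<mu>)" using NM by linarith
    also have "\<dots> = of_nat (N * M) * (lo + 3 * \<mu>)" by (simp add: algebra_simps)
    finally have "a \<le> lo + 3 * \<mu>"
      using NM0 unfolding a_def by (simp add: pos_divide_le_eq mult.commute)
    hence a_hi: "a \<le> hi - \<mu>" by (simp add: \<mu>_def field_simps)
    define b where "b = x - a"
    define c where "c = y1 - a"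
    define d where "d = y2 - b"
    have ge: "\<mu> \<le> a" "\<mu> \<le> b" "\<mu> \<le> c" "\<mu> \<le> d"
      using a_lo a_hi unfolding b_def c_def d_def lo_def hi_def by auto
    define comb where "comb = (\<lambda>k l m n :: nat. of_nat k * a + of_nat l * b + of_nat m * c + of_nat n * d)"
    define P' where "P' = {p + comb k l m n | p k l m n. p \<in> P}"
    have P'I: "p + comb k l m n \<in> P'" if "p \<in> P" for p k l m n unfolding P'_def using that by blast
    have P'E: thesis if "u \<in> P'" "\<And>p k l m n. u = p + comb k l m n \<Longrightarrow> p \<in> P \<Longrightarrow> thesis" for u thesis
      using that unfolding P'_def by blast
    note zero = good_coneD(3)[OF P]
    have add: "u + v \<in> P" if "u \<in> P" "v \<in> P" for u v using good_coneD(4)[OF P] that by blast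
    have PG: "u \<in> frac_grp N" if "u \<in> P" for u using good_coneD(2)[OF P] that by blast
    have Pmult: "of_nat n * u \<in> P" if "u \<in> P" for n u
      using closed_of_nat_mult[of P] zero add that by blast
    have sub: "P \<subseteq> P'" using P'I[of _ 0 0 0 0] by (force simp: comb_def)
    have gens: "a \<in> P'" "b \<in> P'" "c \<in> P'" "d \<in> P'"
      using P'I[OF zero, of 1 0 0 0] P'I[OF zero, of 0 1 0 0] P'I[OF zero, of 0 0 1 0] P'I[OF zero, of 0 0 0 1]
      by (auto simp: comb_def)
    have comb_ge: "of_nat (k + l + m + n) * \<mu> \<le> comb k l m n" for k l m n
      unfolding comb_def of_nat_add distrib_right
      by (intro add_mono mult_left_mono ge) auto
    have comb_nonneg: "0 \<le> comb k l m n" for k l m n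
      unfolding comb_def using ge \<mu> by (intro add_nonneg_nonneg mult_nonneg_nonneg) auto
    have good: "good_cone (N * M) P'"
    proof (rule good_cone_extend[OF P M i(2) sub])
      show "P' \<subseteq> frac_grp (N * M)"
      proof
        fix u assume "u \<in> P'"
        then obtain p k l m n where u: "u = p + comb k l m n" "p \<in> P" by (rule P'E)
        have PG': "v \<in> frac_grp (N * M)" if "v \<in> P" for v
          using PG[OF that] frac_grp_mono[of N "N * M"] by auto
        have "a \<in> frac_grp (N * M)"
          unfolding a_def by (rule frac_grp_fraction) (use N M in auto)
        moreover from this have "b \<in> frac_grp (N * M)" "c \<in> frac_grp (N * M)"
          unfolding b_def c_def using PG'[OF mem(1)] PG'[OF mem(2)] by (auto intro: frac_grp_diff)
        moreover from this have "d \<in> frac_grp (N * M)"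
          unfolding d_def using PG'[OF mem(3)] by (auto intro: frac_grp_diff)
        ultimately show "u \<in> frac_grp (N * M)"
          unfolding u comb_def using PG'[OF u(2)]
          by (intro frac_grp_add frac_grp_mult_Ints) auto
      qed
      show "u + v \<in> P'" if uv: "u \<in> P'" "v \<in> P'" for u v
      proof -
        obtain p k l m n where u: "u = p + comb k l m n" "p \<in> P" using uv(1) by (rule P'E)
        obtain p' k' l' m' n' where v: "v = p' + comb k' l' m' n'" "p' \<in> P" using uv(2) by (rule P'E)
        have "u + v = (p + p') + comb (k + k') (l + l') (m + m') (n + n')"
          unfolding u v comb_def by (simp add: algebra_simps)
        thus ?thesis using P'I[OF add[OF u(2) v(2)]] by metis
      qed
      show "0 \<le> u" if "u \<in> P'" for u
        using that good_coneD(5)[OF P] comb_nonneg by (elim P'E) (simp add: add_nonneg_nonneg)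
      show "of_int i / of_nat (N * M) \<in> P'" using gens(1) unfolding a_def .
    qed
    have "u \<in> P" if u: "u \<in> P'" "u \<in> frac_grp N" for u
    proof -
      obtain p k l m n where up: "u = p + comb k l m n" "p \<in> P" using u(1) by (rule P'E)
      \<comment> \<open>Modulo \<open>frac_grp N\<close> the entries \<open>b\<close> and
        \<open>c\<close> are \<open>-a\<close>, while \<open>d\<close> is \<open>a\<close>; hence
        the signs.\<close>
      have "of_int (int k - int l - int m + int n) * a
          = (u - p) - of_nat l * x - of_nat m * y1 - of_nat n * (y2 - x)"
        unfolding up comb_def d_def c_def b_def by (simp add: algebra_simps)
      also have "\<dots> \<in> frac_grp N"
        using u(2) PG[OF up(2)] mem
        by (intro frac_grp_diff frac_grp_mult_Ints) (auto intro: PG)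
      finally have dv: "int M dvd int k - int l - int m + int n"
        using fraction_order[OF N M i(2)] unfolding a_def by metis
      show ?thesis
      proof (cases "k + n = l + m")
        case True
        have "comb k l m n \<in> P"
        proof (cases "k \<le> l")
          case le: True
          then obtain r where r: "l = k + r" using le_Suc_ex by blast
          hence "n = r + m" using True by simp
          \<comment> \<open>The generators pair up along rows and columns of the matrix:
            \<open>a + b = x\<close>, \<open>b + d = y2\<close>, \<open>c + d = y1 + y2 - x\<close>.
            For \<open>k > l\<close> the surplus is instead paired by
            \<open>a + c = y1\<close>.\<close>
          hence "comb k l m n = of_nat k * x + of_nat r * y2 + of_nat m * (y1 + y2 - x)"
            unfolding comb_def r d_def c_def b_def by (simp add: algebra_simps)
          thus ?thesis using mem by (auto intro!: add Pmult)
        next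
          case False
          then obtain r where r: "k = l + r" by (metis le_Suc_ex nat_le_linear)
          hence "m = r + n" using True by simp
          hence "comb k l m n = of_nat l * x + of_nat r * y1 + of_nat n * (y1 + y2 - x)"
            unfolding comb_def r d_def c_def b_def by (simp add: algebra_simps)
          thus ?thesis using mem by (auto intro!: add Pmult)
        qed
        thus ?thesis using up add by blast
      next
        case False
        hence "int k - int l - int m + int n \<noteq> 0" by linarith
        hence "int M \<le> \<bar>int k - int l - int m + int n\<bar>" using dv dvd_imp_le_int[of _ "int M"] by simp
        hence "M \<le> k + l + m + n" by linarith
        hence "(of_nat M :: rat) \<le> of_nat (k + l + m + n)" by (simp only: of_nat_le_iff)
        hence "of_nat M * \<mu> \<le> of_nat (k + l + m + n) * \<mu>" using \<mu> by (intro mult_right_mono) auto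
        hence "R \<le> comb k l m n" using M1 comb_ge[of k l m n] by linarith
        hence "R \<le> u" using up good_coneD(5)[OF P up(2)] by linarith
        thus ?thesis using R u(2) by blast
      qed
    qed
    moreover have "x = a + b" "y1 - a = c" "y2 - b = d" by (auto simp: b_def c_def d_def)
    ultimately show ?thesis using good sub gens by (intro exI[of _ P']) auto
  qed
  show ?thesis by (intro exI[of _ "B1 + B2"] allI impI) (rule main)
qed

section \<open>Prime powers dividing a generalized integer\<close>

lemma gi_dvd_mult_infinite:
  assumes "gi_dvd N g" "A > 0" "\<And>p. prime p \<Longrightarrow> p dvd A \<Longrightarrow> g p = \<infinity>"
  shows "gi_dvd (N * A) g"
  unfolding gi_dvd_def
proof (intro conjI allI impI)
  show "N * A > 0" using assms by (simp add: gi_dvd_def)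
  fix p :: nat assume p: "prime p"
  show "enat (multiplicity p (N * A)) \<le> g p"
  proof (cases "p dvd A")
    case True thus ?thesis using assms(3) p by simp
  next
    case False
    hence "multiplicity p (N * A) = multiplicity p N"
      using p assms(1,2)
      by (subst prime_elem_multiplicity_mult_distrib)
        (auto simp: gi_dvd_def not_dvd_imp_multiplicity_0)
    thus ?thesis using assms(1) p by (simp add: gi_dvd_def)
  qed
qed

lemma gi_dvd_mult_new_prime:
  assumes "gi_dvd N g" "prime p" "\<not> p dvd N" "g p \<noteq> 0"
  shows "gi_dvd (N * p) g"
  unfolding gi_dvd_def
proof (intro conjI allI impI)
  have N: "N > 0" using assms by (simp add: gi_dvd_def)
  thus "N * p > 0" using assms by (simp add: prime_gt_0_nat)
  fix r :: nat assume r: "prime r"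
  have "multiplicity r (N * p) = multiplicity r N + multiplicity r p"
    using r N assms(2) by (subst prime_elem_multiplicity_mult_distrib) auto
  moreover have "multiplicity r N = 0" if "r = p" 
    using that assms(3) by (simp add: not_dvd_imp_multiplicity_0)
  moreover have "multiplicity r p = (if r = p then 1 else 0)"
    using r assms(2) by (auto simp: prime_multiplicity_other)
  moreover have "1 \<le> g p" using assms(4) by (cases "g p") (auto simp: one_enat_def zero_enat_def)
  ultimately show "enat (multiplicity r (N * p)) \<le> g r"
    using assms(1) r by (auto simp: gi_dvd_def one_enat_def)
qed

lemma gi_dvd_lcm: "gi_dvd a g \<Longrightarrow> gi_dvd b g \<Longrightarrow> gi_dvd (lcm a b) g"
  unfolding gi_dvd_def by (auto simp: multiplicity_lcm lcm_pos_nat max_def)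

text \<open>A prime with infinite exponent supplies all its powers. Otherwise infinitely many primes
  occur in \<open>g\<close>, and some large one does not divide \<open>N\<close>, so it can be
  adjoined once.\<close>

lemma gi_infinite_prime_power:
  assumes "gi_infinite g" "gi_dvd N g"
  shows "\<exists>p e. prime p \<and> B \<le> p ^ e \<and> gi_dvd (N * p ^ e) g"
proof (cases "\<exists>p. prime p \<and> g p = \<infinity>")
  case True
  then obtain p where p: "prime p" "g p = \<infinity>" by blast
  have "B \<le> p ^ B"
    using self_le_ge2_pow[of p B] prime_ge_2_nat[OF p(1)] by blast
  moreover have "gi_dvd (N * p ^ B) g"
  proof (rule gi_dvd_mult_infinite[OF assms(2)])
    show "p ^ B > 0" using p(1) by (simp add: prime_gt_0_nat)
    show "g r = \<infinity>" if "prime r" "r dvd p ^ B" for r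
      using that p prime_dvd_power primes_dvd_imp_eq by blast
  qed
  ultimately show ?thesis using p by blast
next
  case False
  hence "infinite {p. prime p \<and> g p \<noteq> 0}" using assms(1) unfolding gi_infinite_def by auto
  moreover have "finite ({..B} \<union> {p. p dvd N})"
    using assms(2) by (auto simp: gi_dvd_def)
  ultimately obtain p where "p \<in> {p. prime p \<and> g p \<noteq> 0} - ({..B} \<union> {p. p dvd N})"
    by (metis Diff_infinite_finite ex_in_conv finite.emptyI)
  hence "prime p \<and> B \<le> p ^ 1 \<and> gi_dvd (N * p ^ 1) g"
    using gi_dvd_mult_new_prime[OF assms(2)] by auto
  thus ?thesis by blast
qed

lemma good_cone_refine:
  assumes "gi_infinite g" "gi_dvd N g" and P: "good_cone N P"
  shows "\<exists>M P'. gi_dvd (N * M) g \<and> good_cone (N * M) P' \<and> P \<subseteq> P' \<and> P' \<inter> frac_grp N \<subseteq> P \<and>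
    (x \<in> P \<longrightarrow> y1 \<in> P \<longrightarrow> y2 \<in> P \<longrightarrow> y1 + y2 - x \<in> P \<longrightarrow>
      (\<exists>x1\<in>P'. \<exists>x2\<in>P'. x = x1 + x2 \<and> y1 - x1 \<in> P' \<and> y2 - x2 \<in> P'))"
proof (cases "x \<in> P \<and> y1 \<in> P \<and> y2 \<in> P \<and> y1 + y2 - x \<in> P \<and>
    0 < x \<and> 0 < y1 \<and> 0 < y2 \<and> x < y1 + y2")
  case True
  then obtain B where B: "\<And>M p e. prime p \<Longrightarrow> M = p ^ e \<Longrightarrow> B \<le> M \<Longrightarrow>
    \<exists>P'. good_cone (N * M) P' \<and> P \<subseteq> P' \<and> P' \<inter> frac_grp N \<subseteq> P \<and>
      (\<exists>x1\<in>P'. \<exists>x2\<in>P'. x = x1 + x2 \<and> y1 - x1 \<in> P' \<and> y2 - x2 \<in> P')"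
    using good_cone_adjoin_refinement[OF P, of x y1 y2] by blast
  obtain p e where pe: "prime p" "B \<le> p ^ e" "gi_dvd (N * p ^ e) g"
    using gi_infinite_prime_power[OF assms(1,2)] by blast
  then show ?thesis using B[OF pe(1) refl pe(2)] by (intro exI[of _ "p ^ e"]) auto
next
  case False
  \<comment> \<open>If one of \<open>x\<close>, \<open>y1\<close>, \<open>y2\<close>,
    \<open>y1 + y2 - x\<close> is zero, a refinement already lies in \<open>P\<close>, so
    \<open>M = 1\<close> suffices.\<close>
  have "\<exists>x1\<in>P. \<exists>x2\<in>P. x = x1 + x2 \<and> y1 - x1 \<in> P \<and> y2 - x2 \<in> P"
    if mem: "x \<in> P" "y1 \<in> P" "y2 \<in> P" "y1 + y2 - x \<in> P"
  proof -
    note zero = good_coneD(3)[OF P] and nonneg = good_coneD(5)[OF P]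
    have "0 \<le> x" "0 \<le> y1" "0 \<le> y2" "0 \<le> y1 + y2 - x" using mem nonneg by blast+
    then consider "x = 0" | "y1 = 0" | "y2 = 0" | "x = y1 + y2" using False mem by linarith
    thus ?thesis
    proof cases
      case 1 thus ?thesis using mem zero by (intro bexI[of _ 0]) auto
    next
      case 2 thus ?thesis using mem zero by (intro bexI[of _ 0] bexI[of _ x]) auto
    next
      case 3 thus ?thesis using mem zero by (intro bexI[of _ 0] bexI[of _ x]) auto
    next
      case 4 thus ?thesis using mem zero by (intro bexI[of _ y1] bexI[of _ y2]) auto
    qed
  qed
  thus ?thesis using assms(2) P by (intro exI[of _ 1] exI[of _ P]) auto
qed

section \<open>Intervals generated by chains\<close>

definition chain_ideal :: "rat set \<Rightarrow> (nat \<Rightarrow> rat) \<Rightarrow> rat set" where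
  "chain_ideal P d = {z \<in> P. \<exists>n. le_P P z (d n)}"

lemma pogroupD:
  assumes "pogroup G P"
  shows "P \<subseteq> G" "0 \<in> P" "x \<in> P \<Longrightarrow> y \<in> P \<Longrightarrow> x + y \<in> P" "x \<in> P \<Longrightarrow> - x \<in> P \<Longrightarrow> x = 0"
  using assms unfolding pogroup_def by auto

lemma le_P_refl: "pogroup G P \<Longrightarrow> le_P P x x"
  by (simp add: le_P_def pogroupD)

lemma le_P_trans: "pogroup G P \<Longrightarrow> le_P P x y \<Longrightarrow> le_P P y z \<Longrightarrow> le_P P x z"
  unfolding le_P_def using pogroupD(3)[of G P "z - y" "y - x"] by simp

lemma le_P_add: "pogroup G P \<Longrightarrow> le_P P x y \<Longrightarrow> le_P P x' y' \<Longrightarrow> le_P P (x + x') (y + y')"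
  unfolding le_P_def using pogroupD(3)[of G P "y - x" "y' - x'"] by (simp add: algebra_simps)

lemma le_P_chain:
  assumes "pogroup G P" "\<And>n. le_P P (d n) (d (Suc n))" "m \<le> n"
  shows "le_P P (d m) (d n)"
  using assms(3) by (induction n rule: dec_induct) (use assms le_P_refl le_P_trans in blast)+

lemma chain_in_chain_ideal:
  assumes "pogroup G P" "\<And>n. d n \<in> P"
  shows "d n \<in> chain_ideal P d"
  using assms le_P_refl unfolding chain_ideal_def by blast

lemma cg_interval_chain_ideal:
  assumes P: "pogroup G P" and d: "\<And>n. d n \<in> P" "\<And>n. le_P P (d n) (d (Suc n))"
  shows "cg_interval P (chain_ideal P d)"
  unfolding cg_interval_def interval_def
proof (intro conjI ballI impI)
  show "chain_ideal P d \<noteq> {}" using chain_in_chain_ideal[OF P] d by blast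
  show "chain_ideal P d \<subseteq> P" by (auto simp: chain_ideal_def)
  show "\<exists>z\<in>chain_ideal P d. le_P P x z \<and> le_P P y z"
    if xy: "x \<in> chain_ideal P d" "y \<in> chain_ideal P d" for x y
  proof -
    obtain m n where mn: "le_P P x (d m)" "le_P P y (d n)" using xy unfolding chain_ideal_def by blast
    have "le_P P (d m) (d (max m n))" "le_P P (d n) (d (max m n))"
      using le_P_chain[where d = d, OF P d(2)] by simp_all
    thus ?thesis using mn le_P_trans[OF P] chain_in_chain_ideal[where d = d, OF P d(1)] by blast
  qed
  show "y \<in> chain_ideal P d" if "x \<in> chain_ideal P d" "y \<in> P" "le_P P y x" for x y
    using that le_P_trans[OF P] unfolding chain_ideal_def by blast
  \<comment> \<open>Every set of rationals is countable, so the interval serves as its own cofinal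
    subset.\<close>
  show "\<exists>C. countable C \<and> C \<subseteq> chain_ideal P d \<and> (\<forall>x\<in>chain_ideal P d. \<exists>c\<in>C. le_P P x c)"
    using le_P_refl[OF P] by (intro exI[of _ "chain_ideal P d"]) auto
qed

lemma iplus_chain_ideal:
  assumes P: "pogroup G P"
    and d: "\<And>n. d n \<in> P" "\<And>n. le_P P (d n) (d (Suc n))"
    and e: "\<And>n. e n \<in> P" "\<And>n. le_P P (e n) (e (Suc n))"
  shows "iplus P (chain_ideal P d) (chain_ideal P e) = chain_ideal P (\<lambda>n. d n + e n)"
proof (intro equalityI subsetI)
  fix z assume "z \<in> iplus P (chain_ideal P d) (chain_ideal P e)"
  then obtain x y m n where z: "z \<in> P" "le_P P z (x + y)" "le_P P x (d m)" "le_P P y (e n)"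
    unfolding iplus_def chain_ideal_def by blast
  have "le_P P (d m) (d (max m n))" "le_P P (e n) (e (max m n))"
    using le_P_chain[where d = d, OF P d(2)] le_P_chain[where d = e, OF P e(2)] by simp_all
  hence "le_P P (x + y) (d (max m n) + e (max m n))"
    using z le_P_add[OF P] le_P_trans[OF P] by blast
  thus "z \<in> chain_ideal P (\<lambda>n. d n + e n)"
    using z le_P_trans[OF P] unfolding chain_ideal_def by blast
next
  fix z assume "z \<in> chain_ideal P (\<lambda>n. d n + e n)"
  thus "z \<in> iplus P (chain_ideal P d) (chain_ideal P e)"
    using chain_in_chain_ideal[where d = d, OF P d(1)] chain_in_chain_ideal[where d = e, OF P e(1)]
    unfolding iplus_def chain_ideal_def[of P "\<lambda>n. d n + e n"] by blast
qed

text \<open>This turns equations between multiples of intervals into questions about multiples of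
  single chain elements.\<close>

lemma imult_chain_ideal:
  assumes P: "pogroup G P" and d: "\<And>n. d n \<in> P" "\<And>n. le_P P (d n) (d (Suc n))"
  shows "imult P t (chain_ideal P d) = chain_ideal P (\<lambda>n. of_nat t * d n)"
proof (induction t)
  case 0
  \<comment> \<open>The zero chain generates \<open>{0}\<close> because the cone contains no nonzero
    element together with its negative.\<close>
  show ?case using pogroupD[OF P] by (auto simp: chain_ideal_def le_P_def)
next
  case (Suc t)
  have mem: "of_nat t * d n \<in> P" for n
    using closed_of_nat_mult[of P] pogroupD[OF P] d(1) by blast
  have "of_nat t * (d (Suc n) - d n) \<in> P" for n
    using closed_of_nat_mult[of P] pogroupD[OF P] d(2) unfolding le_P_def by blast
  hence mono: "le_P P (of_nat t * d n) (of_nat t * d (Suc n))" for n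
    by (simp add: le_P_def right_diff_distrib)
  show ?case
    using iplus_chain_ideal[where d = d and e = "\<lambda>n. of_nat t * d n", OF P d mem mono]
    by (simp add: Suc distrib_right)
qed

section \<open>Towers of cones\<close>

text \<open>A refinement comes first; then one root of order \<open>M * K\<close> both makes room
  for the denominator \<open>b\<close> and supplies the quotients by divisors of \<open>K\<close>.
  The denominator stays a divisor of \<open>g\<close> because the primes of \<open>K\<close> have
  infinite exponent.\<close>

lemma cone_tower_step:
  assumes g: "gi_infinite g" "gi_dvd N g" and P: "good_cone N P"
    and K: "K > 0" "\<And>p. prime p \<Longrightarrow> p dvd K \<Longrightarrow> g p = \<infinity>"
  shows "\<exists>N' P' W. gi_dvd N' g \<and> good_cone N' P' \<and> N dvd N' \<and> (gi_dvd b g \<longrightarrow> b dvd N') \<and> P \<subseteq> P' \<and>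
    (x \<in> P \<longrightarrow> y1 \<in> P \<longrightarrow> y2 \<in> P \<longrightarrow> y1 + y2 - x \<in> P \<longrightarrow>
      (\<exists>x1\<in>P'. \<exists>x2\<in>P'. x = x1 + x2 \<and> y1 - x1 \<in> P' \<and> y2 - x2 \<in> P')) \<and>
    B \<le> W \<and> (\<forall>z\<in>P. z \<le> B \<longrightarrow> W - z \<in> P') \<and>
    (\<forall>Q. Q dvd K \<longrightarrow> W / of_nat Q \<in> P' \<and>
      (\<forall>t<Q. \<forall>u\<in>frac_grp N. of_nat t * (W / of_nat Q) + u \<in> P' \<longrightarrow> u \<in> P))"
proof -
  obtain M1 P1 where M1: "gi_dvd (N * M1) g" "good_cone (N * M1) P1" "P \<subseteq> P1" "P1 \<inter> frac_grp N \<subseteq> P"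
    and ref: "x \<in> P \<longrightarrow> y1 \<in> P \<longrightarrow> y2 \<in> P \<longrightarrow> y1 + y2 - x \<in> P \<longrightarrow>
      (\<exists>x1\<in>P1. \<exists>x2\<in>P1. x = x1 + x2 \<and> y1 - x1 \<in> P1 \<and> y2 - x2 \<in> P1)"
    using good_cone_refine[OF g P, of x y1 y2] by blast
  \<comment> \<open>The default \<open>N * M1\<close> leaves the least common multiple unchanged
    when \<open>b\<close> is not an admissible denominator.\<close>
  define b' where "b' = (if gi_dvd b g then b else N * M1)"
  define L where "L = lcm (N * M1) b'"
  have L: "gi_dvd L g" using M1(1) unfolding L_def b'_def by (auto intro: gi_dvd_lcm)
  hence L0: "L > 0" by (simp add: gi_dvd_def)
  obtain M where M: "L = N * M1 * M" unfolding L_def using dvd_lcm1[of "N * M1" b'] by (elim dvdE)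
  have MK: "M * K > 0" using L0 K(1) M by auto
  have LK: "N * M1 * (M * K) = L * K" by (simp add: M)
  obtain W P' where W: "good_cone (L * K) P'" "P1 \<subseteq> P'" "B \<le> W"
    "\<forall>z\<in>frac_grp (N * M1). z \<le> B \<longrightarrow> W - z \<in> P1"
    "\<forall>Q. Q dvd M * K \<longrightarrow> W / of_nat Q \<in> P' \<and>
      (\<forall>t<Q. \<forall>u\<in>frac_grp (N * M1). of_nat t * (W / of_nat Q) + u \<in> P' \<longrightarrow> u \<in> P1)"
    using good_cone_adjoin_root[OF M1(2) MK, of B] unfolding LK by (elim exE conjE) (rule that; assumption)
  have sub: "frac_grp N \<subseteq> frac_grp (N * M1)" by (simp add: frac_grp_mono)
  have PG: "P \<subseteq> frac_grp N" using good_coneD[OF P] by blast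
  have "gi_dvd (L * K) g" using gi_dvd_mult_infinite[OF L K] .
  moreover have "N dvd L * K" unfolding M by simp
  moreover have "b dvd L * K" if "gi_dvd b g" using that unfolding L_def b'_def by simp
  moreover have "W - z \<in> P'" if "z \<in> P" "z \<le> B" for z using W(2,4) that PG sub by blast
  moreover have "W / of_nat Q \<in> P'" if "Q dvd K" for Q using W(5) that by simp
  moreover have "u \<in> P" if "Q dvd K" "t < Q" "u \<in> frac_grp N" "of_nat t * (W / of_nat Q) + u \<in> P'" for Q t u
    using W(5) that sub M1(4) by (meson IntI dvd_mult subset_iff)
  moreover have "x \<in> P \<longrightarrow> y1 \<in> P \<longrightarrow> y2 \<in> P \<longrightarrow> y1 + y2 - x \<in> P \<longrightarrow>
      (\<exists>x1\<in>P'. \<exists>x2\<in>P'. x = x1 + x2 \<and> y1 - x1 \<in> P' \<and> y2 - x2 \<in> P')"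
    using ref W(2) by blast
  moreover have "P \<subseteq> P'" using M1(3) W(2) by blast
  ultimately show ?thesis using W(1,3) by (intro exI[of _ "L * K"] exI[of _ P'] exI[of _ W]) simp
qed

text \<open>Stage \<open>n\<close> refines the triple with code \<open>fst (prod_decode n)\<close>, so that every triple is
  treated at arbitrarily late stages.\<close>

locale cone_tower =
  fixes g :: genint and Q N :: "nat \<Rightarrow> nat" and P :: "nat \<Rightarrow> rat set" and W :: "nat \<Rightarrow> rat"
  assumes Q_pos: "Q n > 0"
    and Q_dvd: "i \<le> j \<Longrightarrow> Q i dvd Q j"
    and gi_dvd_N: "gi_dvd (N n) g"
    and cone: "good_cone (N n) (P n)"
    and N_dvd_Suc: "N n dvd N (Suc n)"
    and exhaust: "gi_dvd n g \<Longrightarrow> n dvd N (Suc n)"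
    and P_Suc: "P n \<subseteq> P (Suc n)"
    and refine: "from_nat (fst (prod_decode n)) = (x, y1, y2) \<Longrightarrow> x \<in> P n \<Longrightarrow> y1 \<in> P n \<Longrightarrow> y2 \<in> P n \<Longrightarrow>
      y1 + y2 - x \<in> P n \<Longrightarrow>
      \<exists>x1\<in>P (Suc n). \<exists>x2\<in>P (Suc n). x = x1 + x2 \<and> y1 - x1 \<in> P (Suc n) \<and> y2 - x2 \<in> P (Suc n)"
    and W_ge: "of_nat n \<le> W n"
    and W_absorb: "z \<in> P n \<Longrightarrow> z \<le> of_nat n \<Longrightarrow> W n - z \<in> P (Suc n)"
    and W_div: "i \<le> n \<Longrightarrow> W n / of_nat (Q i) \<in> P (Suc n)"
    and W_order: "i \<le> n \<Longrightarrow> t < Q i \<Longrightarrow> u \<in> frac_grp (N n) \<Longrightarrow>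
      of_nat t * (W n / of_nat (Q i)) + u \<in> P (Suc n) \<Longrightarrow> u \<in> P n"

lemma cone_tower_exists:
  assumes g: "gi_infinite g"
    and Q: "\<And>n. Q n > 0" "\<And>i j. i \<le> j \<Longrightarrow> Q i dvd Q j"
    and Q_inf: "\<And>p n. prime p \<Longrightarrow> p dvd Q n \<Longrightarrow> g p = \<infinity>"
  shows "\<exists>N P W. cone_tower g Q N P W"
proof -
  define step where "step = (\<lambda>n (N, P) (N', P') W. N dvd N' \<and> (gi_dvd n g \<longrightarrow> n dvd N') \<and> P \<subseteq> P' \<and>
    (case from_nat (fst (prod_decode n)) of (x, y1, y2) \<Rightarrow>
      x \<in> P \<longrightarrow> y1 \<in> P \<longrightarrow> y2 \<in> P \<longrightarrow> y1 + y2 - x \<in> P \<longrightarrow>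
      (\<exists>x1\<in>P'. \<exists>x2\<in>P'. x = x1 + x2 \<and> y1 - x1 \<in> P' \<and> y2 - x2 \<in> P')) \<and>
    of_nat n \<le> W \<and> (\<forall>z\<in>P. z \<le> of_nat n \<longrightarrow> W - z \<in> P') \<and>
    (\<forall>q. q dvd Q n \<longrightarrow> W / of_nat q \<in> P' \<and>
      (\<forall>t<q. \<forall>u\<in>frac_grp N. of_nat t * (W / of_nat q) + u \<in> P' \<longrightarrow> u \<in> (P :: rat set))))"
  define inv where "inv = (\<lambda>(N, P). gi_dvd N g \<and> good_cone N P)"
  have "\<exists>f. \<forall>n. inv (f n) \<and> (\<exists>W. step n (f n) (f (Suc n)) W)"
  proof (rule dependent_nat_choice)
    \<comment> \<open>The tower starts from the natural numbers inside the integers, with conductor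
      bound 0.\<close>
    have "x \<in> \<nat>" if "x \<in> \<int>" "0 \<le> x" for x :: rat
      using that by (metis Ints_cases of_int_0_le_iff of_int_of_nat_eq nonneg_int_cases of_nat_in_Nats)
    hence "good_cone 1 (\<nat> :: rat set)"
      unfolding good_cone_def frac_grp_def
      by (auto simp: Nats_add Nats_subset_Ints[THEN subsetD] elim: Nats_cases intro!: exI[of _ 0])
    moreover have "gi_dvd 1 g" by (simp add: gi_dvd_def flip: zero_enat_def)
    ultimately show "\<exists>x. inv x" unfolding inv_def by auto
  next
    fix s n assume s: "inv s"
    obtain N P where NP: "s = (N, P)" by force
    obtain x y1 y2 :: rat where xy: "from_nat (fst (prod_decode n)) = (x, y1, y2)"
      using prod_cases3 by blast
    have "\<exists>N' P' W. gi_dvd N' g \<and> good_cone N' P' \<and> step n (N, P) (N', P') W"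
      unfolding step_def prod.case xy
      by (rule cone_tower_step[OF g _ _ Q(1) Q_inf]) (use s in \<open>auto simp: inv_def NP\<close>)
    thus "\<exists>y. inv y \<and> (\<exists>W. step n s y W)" unfolding inv_def NP by blast
  qed
  then obtain f where f: "\<And>n. inv (f n)" "\<forall>n. \<exists>W. step n (f n) (f (Suc n)) W" by blast
  obtain W where W: "\<And>n. step n (f n) (f (Suc n)) (W n)" using choice[OF f(2)] by blast
  have "cone_tower g Q (\<lambda>n. fst (f n)) (\<lambda>n. snd (f n)) W"
  proof
    fix n i
    show "gi_dvd (fst (f n)) g" "good_cone (fst (f n)) (snd (f n))"
      using f(1)[of n] by (auto simp: inv_def split: prod.splits)
    note st = W[of n, unfolded step_def case_prod_beta]
    show "fst (f n) dvd fst (f (Suc n))" "snd (f n) \<subseteq> snd (f (Suc n))" "of_nat n \<le> W n"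
      using st by blast+
    show "gi_dvd n g \<Longrightarrow> n dvd fst (f (Suc n))" using st by blast
    show "W n - z \<in> snd (f (Suc n))" if "z \<in> snd (f n)" "z \<le> of_nat n" for z using st that by blast
    show "\<exists>x1\<in>snd (f (Suc n)). \<exists>x2\<in>snd (f (Suc n)). x = x1 + x2 \<and>
        y1 - x1 \<in> snd (f (Suc n)) \<and> y2 - x2 \<in> snd (f (Suc n))"
      if "from_nat (fst (prod_decode n)) = (x, y1, y2)" "x \<in> snd (f n)" "y1 \<in> snd (f n)"
        "y2 \<in> snd (f n)" "y1 + y2 - x \<in> snd (f n)" for x y1 y2
      using st that(2-) unfolding that(1) fst_conv snd_conv by blast
    \<comment> \<open>\<open>step\<close> treats all divisors of \<open>Q n\<close>, among them
      every \<open>Q i\<close> with \<open>i \<le> n\<close>.\<close>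
    show "W n / of_nat (Q i) \<in> snd (f (Suc n))" if "i \<le> n" using st Q(2)[OF that] by blast
    show "u \<in> snd (f n)" if "i \<le> n" "t < Q i" "u \<in> frac_grp (fst (f n))"
      "of_nat t * (W n / of_nat (Q i)) + u \<in> snd (f (Suc n))" for t u
      using st Q(2)[OF that(1)] that by blast
  qed (use Q in auto)
  thus ?thesis by blast
qed

section \<open>The limit cone and its order structure\<close>

context cone_tower
begin

definition C :: "rat set" where "C = (\<Union>n. P n)"

lemma P_mono: "m \<le> n \<Longrightarrow> P m \<subseteq> P n"
  by (rule lift_Suc_mono_le[of P, OF P_Suc])

lemma frac_grp_N_mono: "m \<le> n \<Longrightarrow> frac_grp (N m) \<subseteq> frac_grp (N n)"
  by (rule lift_Suc_mono_le[of "\<lambda>n. frac_grp (N n)", OF frac_grp_mono[OF N_dvd_Suc]])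

text \<open>This is the case \<open>t = 0\<close> of \<open>W_order\<close>.\<close>

lemma P_Suc_inter: "u \<in> P (Suc n) \<Longrightarrow> u \<in> frac_grp (N n) \<Longrightarrow> u \<in> P n"
  using W_order[of n n 0 u] Q_pos[of n] by simp

text \<open>Later stages add no positive elements to an earlier group, so an element can be brought
  down one stage at a time. Membership in the limit is thus decided at any stage whose group
  contains the element.\<close>

lemma C_inter_frac_grp:
  assumes "u \<in> C" "u \<in> frac_grp (N n)"
  shows "u \<in> P n"
proof -
  obtain k where "u \<in> P k" using assms(1) unfolding C_def by blast
  hence "u \<in> P (n + k)" using P_mono[of k "n + k"] by auto
  thus ?thesis
  proof (induction k)
    case (Suc k)
    have "u \<in> frac_grp (N (n + k))" using assms(2) frac_grp_N_mono[of n "n + k"] by auto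
    thus ?case using P_Suc_inter[of u "n + k"] Suc by simp
  qed simp
qed

lemma P_subset_C: "P n \<subseteq> C"
  unfolding C_def by blast

lemma C_cases2:
  assumes "x \<in> C" "y \<in> C"
  obtains n where "x \<in> P n" "y \<in> P n"
proof -
  obtain m n where "x \<in> P m" "y \<in> P n" using assms unfolding C_def by blast
  thus thesis using that P_mono[of m "max m n"] P_mono[of n "max m n"] by auto
qed

lemma C_add: "x \<in> C \<Longrightarrow> y \<in> C \<Longrightarrow> x + y \<in> C"
  by (metis C_cases2 P_subset_C cone good_coneD(4) subset_iff)

lemma zero_in_C: "0 \<in> C"
  using P_subset_C[of 0] good_coneD(3)[OF cone[of 0]] by blast

lemma C_nonneg: "x \<in> C \<Longrightarrow> 0 \<le> x"
  using good_coneD(5)[OF cone] unfolding C_def by blast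

text \<open>By \<open>exhaust\<close>, a divisor \<open>b\<close> of \<open>g\<close> divides
  \<open>N (Suc b)\<close>, so every admissible denominator is reached.\<close>

lemma Zgi_eq: "Zgi g = (\<Union>n. frac_grp (N n))"
proof (intro equalityI subsetI)
  fix x assume "x \<in> Zgi g"
  then obtain a b where x: "gi_dvd b g" "x = of_int a / of_nat b" unfolding Zgi_def by blast
  hence "x \<in> frac_grp b" by (simp add: frac_grp_fraction gi_dvd_def)
  thus "x \<in> (\<Union>n. frac_grp (N n))" using frac_grp_mono[OF exhaust[OF x(1)]] by blast
next
  fix x assume "x \<in> (\<Union>n. frac_grp (N n))"
  then obtain n where "x \<in> frac_grp (N n)" by blast
  then obtain i where "x = of_int i / of_nat (N n)"
    using frac_grpE good_coneD(1)[OF cone] by metis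
  thus "x \<in> Zgi g" using gi_dvd_N unfolding Zgi_def by blast
qed

lemma C_subset_Zgi: "C \<subseteq> Zgi g"
  using good_coneD(2)[OF cone] unfolding C_def Zgi_eq by blast

lemma Zgi_cases2:
  assumes "x \<in> Zgi g" "y \<in> Zgi g"
  obtains n where "x \<in> frac_grp (N n)" "y \<in> frac_grp (N n)"
proof -
  obtain m n where "x \<in> frac_grp (N m)" "y \<in> frac_grp (N n)" using assms unfolding Zgi_eq by blast
  thus thesis using that frac_grp_N_mono[of m "max m n"] frac_grp_N_mono[of n "max m n"] by auto
qed

lemma pogroup_C: "pogroup (Zgi g) C"
  unfolding pogroup_def
proof (intro conjI ballI impI)
  show "0 \<in> Zgi g" using zero_in_C C_subset_Zgi by blast
  show "x + y \<in> Zgi g" if xy: "x \<in> Zgi g" "y \<in> Zgi g" for x y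
  proof -
    obtain n where "x \<in> frac_grp (N n)" "y \<in> frac_grp (N n)" using xy by (rule Zgi_cases2)
    thus ?thesis unfolding Zgi_eq using frac_grp_add by blast
  qed
  show "- x \<in> Zgi g" if "x \<in> Zgi g" for x
    using that frac_grp_minus unfolding Zgi_eq by blast
  show "x = 0" if "x \<in> C" "- x \<in> C" for x
    using C_nonneg[OF that(1)] C_nonneg[OF that(2)] by simp
qed (use C_subset_Zgi zero_in_C C_add in auto)

text \<open>At a stage whose group contains both \<open>x\<close> and \<open>u\<close>, the
  conductor reduces positivity to size, and a large multiple of \<open>u\<close> dominates both
  \<open>x\<close> and \<open>-x\<close>.\<close>

lemma order_unit_C:
  assumes "u \<in> C" "u \<noteq> 0"
  shows "order_unit (Zgi g) C u"
  unfolding order_unit_def le_P_def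
proof (intro conjI ballI assms(1))
  fix x assume "x \<in> Zgi g"
  then obtain n where n: "x \<in> frac_grp (N n)" "u \<in> frac_grp (N n)"
    using assms(1) C_subset_Zgi Zgi_cases2 by blast
  obtain R where R: "\<And>v. v \<in> frac_grp (N n) \<Longrightarrow> R \<le> v \<Longrightarrow> v \<in> P n"
    using good_cone_conductor[OF cone] by blast
  have u: "u > 0" using assms C_nonneg by force
  obtain k :: nat where "(R + \<bar>x\<bar>) / u \<le> of_nat k" using real_arch_simple by blast
  hence k: "R + \<bar>x\<bar> \<le> of_nat k * u" using u by (simp add: pos_divide_le_eq)
  have ku: "of_nat k * u \<in> frac_grp (N n)" using n by (intro frac_grp_mult_Ints) auto
  have "x - - (of_nat k * u) \<in> P n"
    using R[of "x + of_nat k * u"] frac_grp_add[OF n(1) ku] k by auto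
  moreover have "of_nat k * u - x \<in> P n"
    using R[of "of_nat k * u - x"] frac_grp_diff[OF ku n(1)] k by auto
  ultimately show "\<exists>k::nat. x - - (of_nat k * u) \<in> C \<and> of_nat k * u - x \<in> C"
    using P_subset_C by blast
qed

lemma P_nontrivial: "\<exists>z\<in>P n. z > 0"
proof -
  obtain R where R: "\<And>v. v \<in> frac_grp (N n) \<Longrightarrow> R \<le> v \<Longrightarrow> v \<in> P n"
    using good_cone_conductor[OF cone] by blast
  obtain k :: nat where k: "max 1 R \<le> of_nat k" using real_arch_simple by blast
  moreover have "of_nat k \<in> frac_grp (N n)" by (simp add: frac_grp_def)
  ultimately show ?thesis using R[of "of_nat k"] by (intro bexI[of _ "of_nat k"]) auto
qed

lemma simple_C: "simple_pog (Zgi g) C"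
proof -
  obtain z where "z \<in> P 0" "z > 0" using P_nontrivial by blast
  hence "z \<in> Zgi g" "z \<noteq> 0" using P_subset_C C_subset_Zgi by auto
  thus ?thesis unfolding simple_pog_def using pogroup_C order_unit_C by blast
qed

lemma rank_one_Zgi: "rank_one (Zgi g)"
  using simple_C unfolding rank_one_def simple_pog_def by (intro exI[of _ "\<lambda>x. x"]) auto

lemma riesz_C: "riesz_group (Zgi g) C"
  unfolding riesz_group_def le_P_def
proof (intro conjI allI impI pogroup_C)
  fix x y1 y2 assume asm: "x \<in> C \<and> y1 \<in> C \<and> y2 \<in> C \<and> y1 + y2 - x \<in> C"
  obtain m n where mn: "x \<in> P m" "y1 \<in> P m" "y2 \<in> P n" "y1 + y2 - x \<in> P n"
    using asm by (metis C_cases2)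
  \<comment> \<open>The pairing function dominates its second component, so \<open>k\<close> codes
    this triple and is late enough for all four memberships.\<close>
  define k where "k = prod_encode (to_nat (x, y1, y2), m + n)"
  have "m \<le> k" "n \<le> k" using le_prod_encode_2[of "m + n" "to_nat (x, y1, y2)"] unfolding k_def by linarith+
  hence mem: "x \<in> P k" "y1 \<in> P k" "y2 \<in> P k" "y1 + y2 - x \<in> P k" using mn P_mono by blast+
  have "from_nat (fst (prod_decode k)) = (x, y1, y2)" by (simp add: k_def)
  from refine[OF this mem] show "\<exists>x1\<in>C. \<exists>x2\<in>C. x = x1 + x2 \<and> y1 - x1 \<in> C \<and> y2 - x2 \<in> C"
    using P_subset_C by blast
qed

section \<open>The intervals and their multiples\<close>

definition chain :: "nat \<Rightarrow> nat \<Rightarrow> rat" where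
  "chain i n = (\<Sum>j<n. if i \<le> j then W j / of_nat (Q i) else 0)"

definition D :: "nat \<Rightarrow> rat set" where
  "D i = chain_ideal C (chain i)"

lemma chain_0: "chain i 0 = 0"
  by (simp add: chain_def)

lemma chain_Suc: "chain i (Suc n) = chain i n + (if i \<le> n then W n / of_nat (Q i) else 0)"
  by (simp add: chain_def)

text \<open>The summand with index \<open>j\<close> enters the cone at stage \<open>Suc j\<close>;
  this is why the sum stops before \<open>n\<close>.\<close>

lemma chain_in_P: "chain i n \<in> P n"
proof (induction n)
  case 0 show ?case using good_coneD(3)[OF cone] by (simp add: chain_0)
next
  case (Suc n)
  thus ?case using W_div[of i n] P_Suc[of n] good_coneD(4)[OF cone, of _ "Suc n"]
    by (auto simp: chain_Suc)
qed

lemma chain_in_C: "chain i n \<in> C"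
  using chain_in_P P_subset_C by blast

lemma chain_mono: "le_P C (chain i n) (chain i (Suc n))"
  using W_div[of i n] P_subset_C zero_in_C by (auto simp: le_P_def chain_Suc)

lemma cg_interval_D: "cg_interval C (D i)"
  unfolding D_def by (rule cg_interval_chain_ideal[where d = "chain i", OF pogroup_C chain_in_C chain_mono])

lemma imult_D: "imult C t (D i) = chain_ideal C (\<lambda>n. of_nat t * chain i n)"
  unfolding D_def by (rule imult_chain_ideal[where d = "chain i", OF pogroup_C chain_in_C chain_mono])

text \<open>The factor \<open>Q i\<close> cancels the denominator, so the \<open>n\<close>-th step
  adds a full \<open>W n\<close>. For \<open>n\<close> beyond \<open>i\<close>, beyond the stage of
  \<open>z\<close> and beyond its size, this alone absorbs \<open>z\<close>.\<close>

lemma imult_D_eq: "imult C (Q i) (D i) = C"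
proof -
  have "\<exists>n. le_P C z (of_nat (Q i) * chain i n)" if zC: "z \<in> C" for z
  proof -
    obtain m where m: "z \<in> P m" using zC unfolding C_def by blast
    obtain l :: nat where l: "z \<le> of_nat l" using real_arch_simple by blast
    define n where "n = i + m + l"
    have "z \<in> P n" using m P_mono[of m n] by (auto simp: n_def)
    moreover have "z \<le> of_nat n" using l by (rule order_trans) (simp add: n_def)
    ultimately have "W n - z \<in> C" using W_absorb P_subset_C by blast
    moreover have "of_nat (Q i) * chain i n \<in> C"
      using closed_of_nat_mult[of C] zero_in_C C_add chain_in_C by blast
    moreover have "of_nat (Q i) * chain i (Suc n) = of_nat (Q i) * chain i n + W n"
      using Q_pos[of i] by (simp add: chain_Suc n_def distrib_left)
    ultimately have "of_nat (Q i) * chain i (Suc n) - z \<in> C"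
      using C_add[of "of_nat (Q i) * chain i n" "W n - z"] by (simp add: add_diff_eq)
    thus ?thesis unfolding le_P_def by blast
  qed
  thus ?thesis unfolding imult_D chain_ideal_def by blast
qed

text \<open>Passing from stage \<open>n\<close> to \<open>n + 1\<close> adds to \<open>of_nat t * chain i n - z\<close> an element of
  nonzero class, which \<open>W_order\<close> allows us to remove again.\<close>

lemma imult_D_neq:
  assumes "t < Q i"
  shows "imult C t (D i) \<noteq> C"
proof -
  obtain z where z: "z \<in> P i" "z > 0" using P_nontrivial by blast
  have notin: "of_nat t * chain i (i + k) - z \<notin> P (i + k)" for k
  proof (induction k)
    case 0
    \<comment> \<open>At stage \<open>i\<close> the chain has no nonzero term yet, so the difference
      is the negative number \<open>-z\<close>.\<close>
    have "chain i i = 0" by (simp add: chain_def)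
    thus ?case using z good_coneD(5)[OF cone, of "- z"] by force
  next
    case (Suc k)
    define u where "u = of_nat t * chain i (i + k) - z"
    have zk: "z \<in> P (i + k)" using z P_mono[of i "i + k"] by auto
    have "of_nat t * chain i (i + k) \<in> frac_grp (N (i + k))"
      using chain_in_P good_coneD(2)[OF cone] by (intro frac_grp_mult_Ints) auto
    hence "u \<in> frac_grp (N (i + k))"
      unfolding u_def using zk good_coneD(2)[OF cone] by (intro frac_grp_diff) auto
    moreover have "of_nat t * chain i (i + Suc k) - z = of_nat t * (W (i + k) / of_nat (Q i)) + u"
      by (simp add: chain_Suc u_def distrib_left)
    ultimately show ?case
      using W_order[of i "i + k" t u] assms Suc unfolding u_def[symmetric] by auto
  qed
  have "\<not> le_P C z (of_nat t * chain i n)" for n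
  proof
    assume le: "le_P C z (of_nat t * chain i n)"
    \<comment> \<open>Passing to the later chain element \<open>chain i (i + n)\<close> allows the
      comparison to be tested at stage \<open>i + n\<close>, where \<open>notin\<close>
      applies.\<close>
    have "le_P C (chain i n) (chain i (i + n))"
      using le_P_chain[where d = "chain i", OF pogroup_C chain_mono] by simp
    hence "of_nat t * (chain i (i + n) - chain i n) \<in> C"
      using closed_of_nat_mult[of C] zero_in_C C_add unfolding le_P_def by blast
    hence "of_nat t * chain i (i + n) - z \<in> C"
      using C_add le unfolding le_P_def by (fastforce simp: right_diff_distrib)
    moreover have "of_nat t * chain i (i + n) \<in> frac_grp (N (i + n))"
      using chain_in_P good_coneD(2)[OF cone] by (intro frac_grp_mult_Ints) auto
    moreover have "z \<in> frac_grp (N (i + n))"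
      using z(1) good_coneD(2)[OF cone, of i] frac_grp_N_mono[of i "i + n"] by auto
    ultimately show False using C_inter_frac_grp frac_grp_diff notin by blast
  qed
  hence "z \<notin> imult C t (D i)" unfolding imult_D chain_ideal_def by blast
  thus ?thesis using z(1) P_subset_C by blast
qed

text \<open>The complement is generated by the differences of the two chains. They increase: before
  \<open>k\<close> only the chain of \<open>i\<close> grows, and from \<open>k\<close> on its steps
  are the larger ones, \<open>Q i\<close> being a divisor of \<open>Q k\<close>.\<close>

lemma D_descending:
  assumes "i \<le> k"
  shows "\<exists>Y. cg_interval C Y \<and> iplus C (D k) Y = D i"
proof -
  define y where "y n = chain i n - chain k n" for n
  obtain r where r: "Q k = Q i * r" using Q_dvd[OF assms] by (elim dvdE)
  have r0: "r > 0" using Q_pos[of k] r by (cases r) auto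
  have step: "y (Suc n) - y n \<in> C" for n
  proof (cases "k \<le> n")
    case True
    \<comment> \<open>One of these \<open>r\<close> copies is spent on the chain of
      \<open>k\<close>; the other \<open>r - 1\<close> form the step of \<open>y\<close>.\<close>
    have "W n / of_nat (Q i) = of_nat r * (W n / of_nat (Q k))"
      using r0 Q_pos[of i] by (simp add: r)
    hence "y (Suc n) - y n = of_nat (r - 1) * (W n / of_nat (Q k))"
      using True assms r0 by (simp add: y_def chain_Suc of_nat_diff left_diff_distrib diff_divide_distrib)
    moreover have "W n / of_nat (Q k) \<in> C" using W_div[OF True] P_subset_C by blast
    ultimately show ?thesis using closed_of_nat_mult[of C] zero_in_C C_add by metis
  next
    case False
    hence "y (Suc n) - y n = (if i \<le> n then W n / of_nat (Q i) else 0)"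
      by (simp add: y_def chain_Suc)
    thus ?thesis using W_div[of i n] P_subset_C zero_in_C by auto
  qed
  have mem: "y n \<in> C" for n
  proof (induction n)
    case 0 show ?case using zero_in_C by (simp add: y_def chain_0)
  next
    case (Suc n) thus ?case using C_add[OF Suc step[of n]] by simp
  qed
  have mono: "le_P C (y n) (y (Suc n))" for n using step by (simp add: le_P_def)
  have "iplus C (D k) (chain_ideal C y) = chain_ideal C (\<lambda>n. chain k n + y n)"
    unfolding D_def
    by (rule iplus_chain_ideal[where d = "chain k" and e = y, OF pogroup_C chain_in_C chain_mono mem mono])
  also have "\<dots> = D i" by (simp add: D_def y_def)
  finally show ?thesis using cg_interval_chain_ideal[where d = y, OF pogroup_C mem mono] by blast
qed

section \<open>States and unboundedness\<close>

text \<open>In rank one a state is determined by its normalization: if \<open>x / u = p / q\<close>,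
  then \<open>q * x = p * u\<close>, and additivity gives the value at \<open>x\<close>.\<close>

lemma state_C_eq:
  assumes "state (Zgi g) C u s" "x \<in> C" "u \<in> C" "u > 0"
  shows "s x = of_rat (x / u)"
proof -
  have add: "\<And>v w. v \<in> Zgi g \<Longrightarrow> w \<in> Zgi g \<Longrightarrow> s (v + w) = s v + s w" and su: "s u = 1"
    using assms(1) unfolding state_def by blast+
  have s0: "s 0 = 0" using add[of 0 0] zero_in_C C_subset_Zgi by force
  have mult: "s (of_nat n * v) = of_nat n * s v" if v: "v \<in> C" for n v
  proof (induction n)
    case (Suc n)
    have "of_nat n * v \<in> C" using closed_of_nat_mult[of C] zero_in_C C_add v by blast
    thus ?case using add[of v "of_nat n * v"] Suc v C_subset_Zgi by (auto simp: distrib_right)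
  qed (simp add: s0)
  obtain p q where pq: "x / u = of_int p / of_int q" "q > 0" 
    by (metis Rat_cases Fract_of_int_quotient)
  have "0 \<le> x / u" using C_nonneg[OF assms(2)] assms(4) by simp
  hence p: "p \<ge> 0" using pq by (simp add: zero_le_divide_iff)
  have "of_nat (nat q) * x = of_nat (nat p) * u"
    using pq p assms(4) by (simp add: field_simps)
  hence "of_nat (nat q) * s x = of_nat (nat p) * s u"
    using mult[OF assms(2), of "nat q"] mult[OF assms(3), of "nat p"] by metis
  hence "s x = of_int p / of_int q" using pq(2) p su by (simp add: field_simps)
  thus ?thesis by (simp add: pq(1) of_rat_divide)
qed

text \<open>A single summand \<open>W n / Q i\<close> suffices, since \<open>W n\<close> is at least
  \<open>n\<close> and \<open>Q i\<close> is fixed.\<close>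

lemma chain_unbounded: "\<exists>n. B \<le> chain i n"
proof -
  obtain m :: nat where m: "B * of_nat (Q i) \<le> of_nat m" using real_arch_simple by blast
  define n where "n = i + m"
  have "(0::rat) \<le> of_nat i" by simp
  hence "B * of_nat (Q i) \<le> W n" using m W_ge[of n] unfolding n_def of_nat_add by linarith
  hence "B \<le> W n / of_nat (Q i)" using Q_pos[of i] by (simp add: pos_le_divide_eq)
  also have "\<dots> \<le> chain i (Suc n)"
    using C_nonneg[OF chain_in_C[of i n]] by (simp add: chain_Suc n_def)
  finally show ?thesis by blast
qed

lemma unbounded_D: "unbounded_interval (Zgi g) C (D i)"
proof -
  obtain u where "u \<in> P 0" "u > 0" using P_nontrivial by blast
  hence u: "u \<in> C" "u > 0" using P_subset_C by auto
  have "\<exists>x\<in>D i. s x > M" if s: "state (Zgi g) C u s" for s and M :: real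
  proof -
    obtain r :: rat where r: "M < of_rat r" using of_rat_dense[of M "M + 1"] by auto
    obtain n where "r * u \<le> chain i n" using chain_unbounded by blast
    hence "r \<le> chain i n / u" using u by (simp add: pos_le_divide_eq)
    hence "of_rat r \<le> s (chain i n)"
      unfolding state_C_eq[OF s chain_in_C u] by (simp add: of_rat_less_eq)
    moreover have "chain i n \<in> D i"
      unfolding D_def by (rule chain_in_chain_ideal[where d = "chain i", OF pogroup_C chain_in_C])
    ultimately show ?thesis using r by (intro bexI[of _ "chain i n"]) auto
  qed
  thus ?thesis using order_unit_C[OF u(1)] u unfolding unbounded_interval_def by blast
qed

end

section \<open>Infinite exponents and the choice of the tower\<close>

text \<open>Each of the infinitely many occurrences of \<open>b\<close> contributes at least 1 to
  the exponent of \<open>p\<close>.\<close>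

lemma gi_prod_eq_infinity:
  assumes p: "prime p" "p dvd b" "b > 0" and inf: "infinite {j. j \<ge> 1 \<and> a j = b}"
  shows "gi_prod a p = \<infinity>"
proof -
  have "\<exists>k. n \<le> (\<Sum>j\<in>{1..k}. multiplicity p (a j))" for n
  proof -
    obtain F where F: "F \<subseteq> {j. j \<ge> 1 \<and> a j = b}" "finite F" "card F = n"
      using infinite_arbitrarily_large[OF inf] by blast
    have "1 \<le> multiplicity p b" using p
      by (metis Suc_leI One_nat_def neq0_conv not_prime_unit prime_multiplicity_gt_zero_iff prime_imp_prime_elem)
    hence "(\<Sum>j\<in>F. 1) \<le> (\<Sum>j\<in>F. multiplicity p (a j))"
      using F(1) by (intro sum_mono) auto
    hence "n \<le> (\<Sum>j\<in>F. multiplicity p (a j))" by (simp add: F(3))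
    also have "\<dots> \<le> (\<Sum>j\<in>{1..Max (insert 0 F)}. multiplicity p (a j))"
      using F by (intro sum_mono2) auto
    finally show ?thesis by auto
  qed
  hence "enat n \<le> gi_prod a p" for n
    unfolding gi_prod_def by (metis SUP_upper2 UNIV_I enat_ord_simps(1))
  thus ?thesis by (cases "gi_prod a p") (auto simp: not_less_eq_eq[symmetric] dest: spec, meson Suc_n_not_le_n enat_ord_simps(1))
qed

lemma gi_infinite_gi_mult:
  assumes "gi_infinite m"
  shows "gi_infinite (gi_mult n m)"
proof -
  have "{p. prime p \<and> m p \<noteq> 0} \<subseteq> {p. prime p \<and> gi_mult n m p \<noteq> 0}"
    by (auto simp: gi_mult_def)
  hence "finite {p. prime p \<and> m p \<noteq> 0}" if "finite {p. prime p \<and> gi_mult n m p \<noteq> 0}"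
    using that finite_subset by blast
  moreover have "gi_mult n m p = \<infinity>" if "m p = \<infinity>" for p
    using that by (simp add: gi_mult_def)
  ultimately show ?thesis using assms unfolding gi_infinite_def by metis
qed

theorem theorem3p7:
  fixes q a :: "nat \<Rightarrow> nat" and m :: genint
  assumes q_pos: "\<forall>i\<ge>1. q i > 0"
    and q_coprime: "\<forall>i\<ge>1. \<forall>j\<ge>1. i \<noteq> j \<longrightarrow> gcd (q i) (q j) = 1"
    and a_in_J: "\<forall>j\<ge>1. \<exists>i\<ge>1. a j = q i"
    and a_inf: "\<forall>i\<ge>1. infinite {j. j \<ge> 1 \<and> a j = q i}"
    and m_inf: "gi_infinite m"
    and m_coprime: "gi_coprime m (gi_prod a)"
  shows "let G = Zgi (gi_mult (gi_prod a) m) in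
    \<exists>P D. simple_pog G P \<and> riesz_group G P \<and> rank_one G \<and>
      (\<forall>i\<ge>1. cg_interval P (D i) \<and> unbounded_interval G P (D i)) \<and>
      (\<forall>i\<ge>1. \<exists>Y. cg_interval P Y \<and> iplus P (D (Suc i)) Y = D i) \<and>
      (\<forall>i\<ge>1. imult P (\<Prod>j\<in>{1..i}. q j) (D i) = P) \<and>
      (\<forall>i\<ge>1. \<forall>t::nat. 1 \<le> t \<and> t \<le> q i - 1 \<longrightarrow> imult P t (D i) \<noteq> P)"
proof -
  define g where "g = gi_mult (gi_prod a) m"
  define Q where "Q i = (\<Prod>j\<in>{1..i}. q j)" for i
  have Q_pos: "Q i > 0" for i unfolding Q_def using q_pos by (intro prod_pos) auto
  have Q_dvd: "Q i dvd Q k" if "i \<le> k" for i k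
    unfolding Q_def using that by (intro prod_dvd_prod_subset) auto
  \<comment> \<open>A prime factor of \<open>Q n\<close> divides some \<open>q j\<close>, which
    recurs infinitely often in \<open>a\<close>. Hence the roots by multiples of \<open>Q n\<close>
    can be adjoined at every stage without leaving the group.\<close>
  have Q_inf: "g p = \<infinity>" if p: "prime p" "p dvd Q n" for p n
  proof -
    obtain j where j: "j \<in> {1..n}" "p dvd q j"
      using p unfolding Q_def by (metis finite_atLeastAtMost prime_dvd_prod_iff)
    have "gi_prod a p = \<infinity>" using gi_prod_eq_infinity[OF p(1) j(2)] j(1) q_pos a_inf by simp
    thus ?thesis by (simp add: g_def gi_mult_def)
  qed
  have "gi_infinite g" unfolding g_def by (rule gi_infinite_gi_mult[OF m_inf])
  then obtain N P W where "cone_tower g Q N P W"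
    using cone_tower_exists[of g Q] Q_pos Q_dvd Q_inf by blast
  then interpret cone_tower g Q N P W .
  \<comment> \<open>The tower excludes every \<open>t < Q i\<close>; the range up to
    \<open>q i - 1\<close> lies below this bound because \<open>q i\<close> divides
    \<open>Q i\<close>.\<close>
  have "t < Q i" if "i \<ge> 1" "t \<le> q i - 1" for i t
  proof -
    have "q i dvd Q i" unfolding Q_def using that(1) by (intro dvd_prodI) auto
    hence "q i \<le> Q i" using Q_pos by (rule dvd_imp_le)
    thus ?thesis using that q_pos by (metis Suc_pred le_imp_less_Suc order_less_le_trans diff_Suc_1 One_nat_def)
  qed
  hence "\<forall>i\<ge>1. \<forall>t::nat. 1 \<le> t \<and> t \<le> q i - 1 \<longrightarrow> imult C t (D i) \<noteq> C"
    using imult_D_neq by blast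
  moreover have "\<forall>i\<ge>1. \<exists>Y. cg_interval C Y \<and> iplus C (D (Suc i)) Y = D i"
    using D_descending by simp
  ultimately show ?thesis
    unfolding Let_def g_def[symmetric] Q_def[symmetric]
    using simple_C riesz_C rank_one_Zgi cg_interval_D unbounded_D imult_D_eq by blast
qed

end
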